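(* Let $n$ be a nonnegative integer and let $q$ be a positive integer. Then $$\sum_{k=0}^n \binom{n}{k} \frac{(-1)^{k}}{(k+q)(n-k+q)} = \frac{(-1)^n + 1}{q (n+2q)\binom{n+q}{n}}.$$ *)

theory Defs
  imports Complex_Main
begin

end

theory Submission
  imports Defs
begin

text \<open>
  The two factors \<open>k + q\<close> and \<open>n - k + q\<close> in the denominator have the sum \<open>n + 2 * q\<close>, which does
  not depend on \<open>k\<close>. Hence the partial fraction decomposition
  \<open>1 / ((k + q) * (n - k + q)) = (1 / (k + q) + 1 / (n - k + q)) / (n + 2 * q)\<close>
  splits the sum into two. The reflection \<open>k \<mapsto> n - k\<close> preserves the binomial coefficient and
  multiplies the sign by \<open>(-1) ^ n\<close>, so the second sum is \<open>(-1) ^ n\<close> times the first. This produces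
  the factor \<open>(-1) ^ n + 1\<close>. The first sum is the classical partial fraction expansion of
  \<open>n! / (x * (x + 1) * \<dots> * (x + n))\<close>, here the lemma \<open>alternating_binomial_sum_inverse\<close>, at \<open>x = q\<close>,
  where the quotient is \<open>1 / (q * (n + q choose n))\<close>.
\<close>

text \<open>
  Pascal's rule in summed form: in the alternating case, where \<open>f\<close> contains a sign \<open>(-1) ^ k\<close>, it
  says that an alternating binomial sum is an iterated difference.
\<close>

lemma sum_Suc_choose:
  fixes f :: "nat \<Rightarrow> 'a::comm_semiring_1"
  shows "(\<Sum>k\<le>Suc n. of_nat (Suc n choose k) * f k)
       = (\<Sum>k\<le>n. of_nat (n choose k) * f k) + (\<Sum>k\<le>n. of_nat (n choose k) * f (Suc k))"
proof -
  have "(\<Sum>k\<le>Suc n. of_nat (Suc n choose k) * f k)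
      = f 0 + (\<Sum>k\<le>n. of_nat (n choose Suc k) * f (Suc k))
            + (\<Sum>k\<le>n. of_nat (n choose k) * f (Suc k))"
    by (subst sum.atMost_Suc_shift) (simp add: algebra_simps sum.distrib)
  also have "f 0 + (\<Sum>k\<le>n. of_nat (n choose Suc k) * f (Suc k))
           = (\<Sum>k\<le>Suc n. of_nat (n choose k) * f k)"
    by (subst sum.atMost_Suc_shift) simp
  also have "\<dots> = (\<Sum>k\<le>n. of_nat (n choose k) * f k)"
    by (simp add: binomial_eq_0)
  finally show ?thesis .
qed

text \<open>
  Both sides are the \<open>n\<close>-th iterated difference of \<open>1 / x\<close>, up to sign: passing from \<open>n\<close> to \<open>n + 1\<close>
  subtracts the value at \<open>x + 1\<close> from the value at \<open>x\<close>. On the right-hand side this step is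
  \<open>1 / (x * \<dots> * (x + n)) - 1 / ((x + 1) * \<dots> * (x + n + 1)) = (n + 1) / (x * \<dots> * (x + n + 1))\<close>.
  The hypothesis says that \<open>x\<close> is none of the poles \<open>0, -1, \<dots>, -n\<close>.
\<close>

lemma alternating_binomial_sum_inverse:
  fixes x :: "'a::field_char_0"
  assumes "pochhammer x (Suc n) \<noteq> 0"
  shows "(\<Sum>k\<le>n. of_nat (n choose k) * ((-1) ^ k / (of_nat k + x)))
       = fact n / pochhammer x (Suc n)"
  using assms
proof (induction n arbitrary: x)
  case 0
  then show ?case by simp
next
  case (Suc n)
  define P where "P = pochhammer x (Suc n)"
  define Q where "Q = pochhammer (x + 1) (Suc n)"
  have last: "pochhammer x (Suc (Suc n)) = P * (x + of_nat (Suc n))"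
    unfolding P_def by (rule pochhammer_Suc)
  have first: "pochhammer x (Suc (Suc n)) = x * Q"
    unfolding Q_def by (rule pochhammer_rec)
  have nz: "x \<noteq> 0" "P \<noteq> 0" "Q \<noteq> 0" "x + of_nat (Suc n) \<noteq> 0"
    using Suc.prems last first by auto
  have "(\<Sum>k\<le>Suc n. of_nat (Suc n choose k) * ((-1) ^ k / (of_nat k + x)))
      = (\<Sum>k\<le>n. of_nat (n choose k) * ((-1) ^ k / (of_nat k + x)))
      - (\<Sum>k\<le>n. of_nat (n choose k) * ((-1) ^ k / (of_nat k + (x + 1))))"
    by (subst sum_Suc_choose) (simp add: sum_negf add_ac)
  also have "\<dots> = fact n / P - fact n / Q"
    using Suc.IH[of x] Suc.IH[of "x + 1"] nz by (simp add: P_def Q_def)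
  also have "fact n / P = fact n * (x + of_nat (Suc n)) / (x * Q)"
    unfolding first[symmetric] last using nz by simp
  also have "fact n / Q = fact n * x / (x * Q)"
    using nz by simp
  also have "fact n * (x + of_nat (Suc n)) / (x * Q) - fact n * x / (x * Q) = fact (Suc n) / (x * Q)"
    by (subst diff_divide_distrib[symmetric]) (simp add: algebra_simps)
  finally show ?case
    by (simp only: first)
qed

lemma pochhammer_of_nat_Suc:
  "pochhammer (of_nat q :: 'a::field_char_0) (Suc n)
     = of_nat q * fact n * of_nat ((n + q) choose n)"
proof -
  have "of_nat ((n + q) choose n) = (pochhammer (of_nat q + 1) n / fact n :: 'a)"
    by (simp add: binomial_gbinomial gbinomial_pochhammer')
  then show ?thesis
    by (simp add: pochhammer_rec)
qed

lemma sum_choose_reflect: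
  fixes f :: "nat \<Rightarrow> 'a::comm_semiring_1"
  shows "(\<Sum>k\<le>n. of_nat (n choose k) * f (n - k)) = (\<Sum>k\<le>n. of_nat (n choose k) * f k)"
proof -
  have "(\<Sum>k\<le>n. of_nat (n choose k) * f (n - k))
      = (\<Sum>k\<le>n. of_nat (n choose (n - k)) * f (n - k))"
    by (intro sum.cong) (simp_all flip: binomial_symmetric)
  also have "\<dots> = (\<Sum>k\<le>n. of_nat (n choose k) * f k)"
    by (rule sum.nat_diff_reindex[of "\<lambda>k. of_nat (n choose k) * f k" "Suc n",
          unfolded lessThan_Suc_atMost, simplified])
  finally show ?thesis .
qed

theorem proposition5p1:
  fixes n q :: nat
  assumes "q > 0"
  shows "(\<Sum>k=0..n. real (n choose k) * ((-1) ^ k / ((real k + real q) * (real n - real k + real q))))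
       = ((-1) ^ n + 1) / (real q * (real n + 2 * real q) * real ((n + q) choose n))"
proof -
  define S where "S = (\<Sum>k\<le>n. real (n choose k) * ((-1) ^ k / (real k + real q)))"
  define N where "N = real n + 2 * real q"
  have S: "S = 1 / (real q * real ((n + q) choose n))"
    unfolding S_def using assms
    by (subst alternating_binomial_sum_inverse) (simp_all add: pochhammer_of_nat_Suc)
  have split: "real (n choose k) * ((-1) ^ k / ((real k + real q) * (real n - real k + real q)))
      = (real (n choose k) * ((-1) ^ k / (real k + real q))
         + (-1) ^ n * (real (n choose k) * ((-1) ^ (n - k) / (real (n - k) + real q)))) / N"
    if "k \<le> n" for k
  proof -
    define a where "a = real k + real q"
    define b where "b = real n - real k + real q"
    have pos: "a > 0" "b > 0" and N: "N = a + b" and b: "real (n - k) + real q = b"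
      using assms that by (auto simp: a_def b_def N_def of_nat_diff)
    have sign: "(-1) ^ n * (-1) ^ (n - k) = ((-1) ^ k :: real)"
      using that by (simp add: minus_one_power_iff)
    have "real (n choose k) * ((-1) ^ k / (a * b))
        = (real (n choose k) * ((-1) ^ k / a) + real (n choose k) * ((-1) ^ k / b)) / (a + b)"
      using pos by (simp add: divide_simps) (simp add: algebra_simps)
    also have "real (n choose k) * ((-1) ^ k / b) = (-1) ^ n * (real (n choose k) * ((-1) ^ (n - k) / b))"
      by (subst sign[symmetric]) (simp only: times_divide_eq_right mult_ac)
    finally show ?thesis
      by (simp only: N b a_def[symmetric] b_def[symmetric])
  qed
  have "(\<Sum>k=0..n. real (n choose k) * ((-1) ^ k / ((real k + real q) * (real n - real k + real q))))
      = (S + (-1) ^ n * (\<Sum>k\<le>n. real (n choose k) * ((-1) ^ (n - k) / (real (n - k) + real q)))) / N"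
    unfolding S_def sum_distrib_left sum.distrib[symmetric] sum_divide_distrib atLeast0AtMost
    by (intro sum.cong refl split) simp
  also have "\<dots> = (S + (-1) ^ n * S) / N"
    by (simp only: S_def sum_choose_reflect[of n "\<lambda>j. (-1) ^ j / (real j + real q)"])
  also have "\<dots> = ((-1) ^ n + 1) / (real q * N * real ((n + q) choose n))"
    by (simp add: S add_divide_distrib mult_ac)
  finally show ?thesis
    by (simp only: N_def)
qed

end
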